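(* Let $f \in K(t)$ such that $v_t(f)$ is odd. Then one of the quadratic forms $\langle 1,\pi\rangle \otimes \langle 1, -\gamma, -t, -f\rangle$ or $\langle 1,\pi\rangle \otimes \langle 1, -\gamma, -t, -\gamma f\rangle$ is anisotropic over $K(t)$.
   Context: $K$ is a p-adic field (finite extension of some $\mathbb{Q}_p$) with fixed uniformizer $\pi$, and $\gamma \in K^*$ is fixed such that $\langle 1,\pi\rangle \otimes \langle 1,-\gamma\rangle$ is anisotropic over $K$. $v_t$ denotes the $t$-adic valuation on $K(t)$ (order of vanishing at $t=0$). *)

theory Defs
  imports
    "HOL-Computational_Algebra.Computational_Algebra"
    "HOL-Algebra.Algebraic_Closure_Type"
begin

section \<open>The field of p-adic numbers\<close>

definition padic_abs :: "nat \<Rightarrow> rat \<Rightarrow> real" where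
  "padic_abs p x =
     (if x = 0 then 0
      else real p powi (int (multiplicity (int p) (snd (quotient_of x)))
                      - int (multiplicity (int p) (fst (quotient_of x)))))"

definition padic_Cauchy :: "nat \<Rightarrow> (nat \<Rightarrow> rat) set" where
  "padic_Cauchy p = {S. \<forall>e>0. \<exists>N. \<forall>m\<ge>N. \<forall>n\<ge>N. padic_abs p (S m - S n) < e}"

definition padic_null :: "nat \<Rightarrow> (nat \<Rightarrow> rat) set" where
  "padic_null p = {S. (\<lambda>n. padic_abs p (S n)) \<longlonglongrightarrow> 0}"

definition padic_Cauchy_ring :: "nat \<Rightarrow> (nat \<Rightarrow> rat) ring" where
  "padic_Cauchy_ring p =
     \<lparr>carrier = padic_Cauchy p, monoid.mult = (\<lambda>S T n. S n * T n), one = (\<lambda>_. 1),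
      ring.zero = (\<lambda>_. 0), add = (\<lambda>S T n. S n + T n)\<rparr>"

text \<open>The field of p-adic numbers is the completion of the rationals at the p-adic absolute
  value: Cauchy sequences modulo null sequences. Its elements are classes of sequences.\<close>

definition padic_numbers :: "nat \<Rightarrow> (nat \<Rightarrow> rat) set ring" where
  "padic_numbers p = padic_Cauchy_ring p Quot padic_null p"

text \<open>An element has absolute value at most 1 iff it is represented by a sequence of rationals
  of absolute value at most 1, because the absolute value along a Cauchy sequence is either
  eventually constant or tends to 0.\<close>

definition padic_integers :: "nat \<Rightarrow> (nat \<Rightarrow> rat) set set" where
  "padic_integers p =
     {z \<in> carrier (padic_numbers p). \<exists>S\<in>z. \<forall>n. padic_abs p (S n) \<le> 1}"

lemma padic_abs_0 [simp]: "padic_abs p 0 = 0"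
  by (simp add: padic_abs_def)

lemma padic_abs_divide:
  assumes p: "prime p" and "a \<noteq> 0" "b \<noteq> 0"
  shows "padic_abs p (of_int a / of_int b)
           = real p powi (int (multiplicity (int p) b) - int (multiplicity (int p) a))"
proof -
  define x :: rat where "x = of_int a / of_int b"
  obtain c d where cd: "quotient_of x = (c, d)" by (cases "quotient_of x") auto
  have x: "x \<noteq> 0" using assms by (simp add: x_def)
  have d: "d > 0" and xcd: "x = of_int c / of_int d"
    using quotient_of_denom_pos[OF cd] quotient_of_div[OF cd] by auto
  have c: "c \<noteq> 0" using x xcd by auto
  have "of_int (a * d) = (of_int (c * b) :: rat)"
    using xcd x_def d assms by (simp add: field_simps)
  hence eq: "a * d = c * b" by (simp only: of_int_eq_iff)
  have P: "prime_elem (int p)" using p by simp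
  have "multiplicity (int p) a + multiplicity (int p) d
          = multiplicity (int p) c + multiplicity (int p) b"
    using prime_elem_multiplicity_mult_distrib[OF P, of a d]
      prime_elem_multiplicity_mult_distrib[OF P, of c b] eq assms c d by simp
  hence "int (multiplicity (int p) d) - int (multiplicity (int p) c)
           = int (multiplicity (int p) b) - int (multiplicity (int p) a)" by linarith
  thus ?thesis using x by (simp add: padic_abs_def cd flip: x_def)
qed

lemma rat_cases_int:
  obtains a b :: int where "b \<noteq> 0" "(x::rat) = of_int a / of_int b"
proof -
  obtain a b where "quotient_of x = (a, b)" by (cases "quotient_of x") auto
  thus ?thesis using that[of b a] quotient_of_denom_pos[of x a b] quotient_of_div[of x a b] by auto
qed

lemma padic_abs_pos: "prime p \<Longrightarrow> x \<noteq> 0 \<Longrightarrow> padic_abs p x > 0"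
  by (simp add: padic_abs_def prime_gt_0_nat)

lemma padic_abs_nonneg: "prime p \<Longrightarrow> padic_abs p x \<ge> 0"
  by (cases "x = 0") (auto dest: padic_abs_pos intro: less_imp_le)

lemma padic_abs_mult:
  assumes p: "prime p"
  shows "padic_abs p (x * y) = padic_abs p x * padic_abs p y"
proof (cases "x = 0 \<or> y = 0")
  case False
  obtain a b where x: "b \<noteq> 0" "x = of_int a / of_int b" by (rule rat_cases_int)
  obtain c d where y: "d \<noteq> 0" "y = of_int c / of_int d" by (rule rat_cases_int)
  have nz: "a \<noteq> 0" "c \<noteq> 0" using False x y by auto
  have xy: "x * y = of_int (a * c) / of_int (b * d)" using x y by simp
  have P: "prime_elem (int p)" using p by simp
  have p0: "real p \<noteq> 0" using p prime_gt_0_nat by force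
  show ?thesis
    unfolding xy using x y nz p0
    by (subst padic_abs_divide[OF p]) (auto simp: padic_abs_divide[OF p]
        prime_elem_multiplicity_mult_distrib[OF P] algebra_simps simp flip: power_int_add)
qed auto

lemma padic_abs_add:
  assumes p: "prime p"
  shows "padic_abs p (x + y) \<le> max (padic_abs p x) (padic_abs p y)"
proof (cases "x = 0 \<or> y = 0 \<or> x + y = 0")
  case True
  thus ?thesis using padic_abs_nonneg[OF p] by (auto simp: max_def)
next
  case False
  obtain a b where x: "b \<noteq> 0" "x = of_int a / of_int b" by (rule rat_cases_int)
  obtain c d where y: "d \<noteq> 0" "y = of_int c / of_int d" by (rule rat_cases_int)
  define A B C where "A = a * d" and "B = c * b" and "C = b * d"
  have C: "C \<noteq> 0" using x y by (simp add: C_def)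
  have xA: "x = of_int A / of_int C" and yB: "y = of_int B / of_int C"
    using x y by (auto simp: A_def B_def C_def)
  have xy: "x + y = of_int (A + B) / of_int C" by (simp add: xA yB add_divide_distrib)
  have nz: "A \<noteq> 0" "B \<noteq> 0" "A + B \<noteq> 0" using False xA yB xy by auto
  define m where "m = min (multiplicity (int p) A) (multiplicity (int p) B)"
  have "int p ^ m dvd A" "int p ^ m dvd B" by (auto simp: m_def intro: multiplicity_dvd')
  hence "int p ^ m dvd A + B" by simp
  hence m: "m \<le> multiplicity (int p) (A + B)"
    using p nz prime_gt_1_nat[OF p] by (intro multiplicity_geI) auto
  have p1: "real p \<ge> 1" using prime_gt_1_nat[OF p] by simp
  have "real p powi (int (multiplicity (int p) C) - int (multiplicity (int p) (A + B)))
          \<le> real p powi (int (multiplicity (int p) C) - int m)"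
    using m p1 by (intro power_int_increasing) auto
  hence "padic_abs p (x + y) \<le> real p powi (int (multiplicity (int p) C) - int m)"
    unfolding xy using padic_abs_divide[OF p nz(3) C] by simp
  moreover have "padic_abs p x = real p powi (int (multiplicity (int p) C) - int (multiplicity (int p) A))"
    "padic_abs p y = real p powi (int (multiplicity (int p) C) - int (multiplicity (int p) B))"
    unfolding xA yB using padic_abs_divide[OF p _ C] nz by auto
  ultimately show ?thesis by (auto simp: m_def min_def split: if_splits)
qed

lemma padic_abs_minus [simp]: "padic_abs p (- x) = padic_abs p x"
  by (cases "quotient_of x") (auto simp: padic_abs_def rat_uminus_code)

lemma padic_abs_minus_commute: "padic_abs p (x - y) = padic_abs p (y - x)"
  using padic_abs_minus[of p "x - y"] by simp

lemma padic_abs_1 [simp]: "padic_abs p 1 = 1"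
  by (simp add: padic_abs_def)

lemma padic_abs_inverse: "prime p \<Longrightarrow> padic_abs p (inverse x) = inverse (padic_abs p x)"
  using padic_abs_mult[of p x "inverse x"]
  by (cases "x = 0") (auto simp: inverse_unique)

lemma padic_abs_add_less:
  assumes "prime p" "padic_abs p x < e" "padic_abs p y < e"
  shows "padic_abs p (x + y) < e"
  using padic_abs_add[OF assms(1), of x y] assms(2,3) by auto

lemma padic_null_iff:
  assumes "prime p"
  shows "S \<in> padic_null p \<longleftrightarrow> (\<forall>e>0. \<exists>N. \<forall>n\<ge>N. padic_abs p (S n) < e)"
  using padic_abs_nonneg[OF assms] by (auto simp: padic_null_def LIMSEQ_iff)

lemma padic_Cauchy_bounded:
  assumes p: "prime p" and S: "S \<in> padic_Cauchy p"
  obtains B where "B > 0" "\<And>n. padic_abs p (S n) < B"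
proof -
  obtain N where N: "\<And>m n. m \<ge> N \<Longrightarrow> n \<ge> N \<Longrightarrow> padic_abs p (S m - S n) < 1"
    using S by (force simp: padic_Cauchy_def)
  define B where "B = 1 + (\<Sum>n\<le>N. padic_abs p (S n))"
  have le: "padic_abs p (S n) < B" if "n \<le> N" for n
    using member_le_sum[of n "{..N}" "\<lambda>n. padic_abs p (S n)"] that padic_abs_nonneg[OF p]
    by (simp add: B_def)
  have B1: "B \<ge> 1" using padic_abs_nonneg[OF p] by (simp add: B_def sum_nonneg)
  have "padic_abs p (S n) < B" for n
  proof (cases "n \<le> N")
    case False
    hence "padic_abs p (S n - S N) < B" using N[of n N] B1 by simp
    from padic_abs_add_less[OF p this le[of N]] show ?thesis by simp
  qed (use le in auto)
  thus ?thesis using that[of B] B1 by simp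
qed

lemma padic_Cauchy_add:
  assumes p: "prime p" and S: "S \<in> padic_Cauchy p" and T: "T \<in> padic_Cauchy p"
  shows "(\<lambda>n. S n + T n) \<in> padic_Cauchy p"
  unfolding padic_Cauchy_def
proof safe
  fix e :: real assume e: "e > 0"
  obtain N where N: "\<And>m n. m \<ge> N \<Longrightarrow> n \<ge> N \<Longrightarrow> padic_abs p (S m - S n) < e"
    using S e by (force simp: padic_Cauchy_def)
  obtain M where M: "\<And>m n. m \<ge> M \<Longrightarrow> n \<ge> M \<Longrightarrow> padic_abs p (T m - T n) < e"
    using T e by (force simp: padic_Cauchy_def)
  have "padic_abs p (S m + T m - (S n + T n)) < e" if "m \<ge> max M N" "n \<ge> max M N" for m n
    using padic_abs_add_less[OF p N[of m n] M[of m n]] that by (simp add: algebra_simps)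
  thus "\<exists>N. \<forall>m\<ge>N. \<forall>n\<ge>N. padic_abs p (S m + T m - (S n + T n)) < e" by blast
qed

lemma padic_Cauchy_uminus: "S \<in> padic_Cauchy p \<Longrightarrow> (\<lambda>n. - S n) \<in> padic_Cauchy p"
  by (simp add: padic_Cauchy_def padic_abs_minus_commute)

lemma padic_Cauchy_const [simp]: "(\<lambda>_. c) \<in> padic_Cauchy p"
  by (simp add: padic_Cauchy_def)

lemma padic_Cauchy_mult:
  assumes p: "prime p" and S: "S \<in> padic_Cauchy p" and T: "T \<in> padic_Cauchy p"
  shows "(\<lambda>n. S n * T n) \<in> padic_Cauchy p"
  unfolding padic_Cauchy_def
proof safe
  fix e :: real assume e: "e > 0"
  obtain B where B: "B > 0" "\<And>n. padic_abs p (S n) < B" by (rule padic_Cauchy_bounded[OF p S]) blast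
  obtain C where C: "C > 0" "\<And>n. padic_abs p (T n) < C" by (rule padic_Cauchy_bounded[OF p T]) blast
  obtain N where N: "\<And>m n. m \<ge> N \<Longrightarrow> n \<ge> N \<Longrightarrow> padic_abs p (S m - S n) < e / C"
    using S e C divide_pos_pos[of e C] by (force simp: padic_Cauchy_def)
  obtain M where M: "\<And>m n. m \<ge> M \<Longrightarrow> n \<ge> M \<Longrightarrow> padic_abs p (T m - T n) < e / B"
    using T e B divide_pos_pos[of e B] by (force simp: padic_Cauchy_def)
  have "padic_abs p (S m * T m - S n * T n) < e" if mn: "m \<ge> max M N" "n \<ge> max M N" for m n
  proof -
    have "padic_abs p ((S m - S n) * T m) < e / C * C"
      unfolding padic_abs_mult[OF p]
      using N[of m n] C mn padic_abs_nonneg[OF p] by (intro mult_strict_mono') auto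
    moreover have "padic_abs p (S n * (T m - T n)) < B * (e / B)"
      unfolding padic_abs_mult[OF p]
      using M[of m n] B mn padic_abs_nonneg[OF p] by (intro mult_strict_mono') auto
    ultimately have "padic_abs p ((S m - S n) * T m + S n * (T m - T n)) < e"
      using B C by (intro padic_abs_add_less[OF p]) auto
    thus ?thesis by (simp add: algebra_simps)
  qed
  thus "\<exists>N. \<forall>m\<ge>N. \<forall>n\<ge>N. padic_abs p (S m * T m - S n * T n) < e" by blast
qed

lemma padic_null_subset: "prime p \<Longrightarrow> padic_null p \<subseteq> padic_Cauchy p"
proof
  fix S assume p: "prime p" and S: "S \<in> padic_null p"
  show "S \<in> padic_Cauchy p" unfolding padic_Cauchy_def
  proof safe
    fix e :: real assume "e > 0"
    then obtain N where N: "\<And>n. n \<ge> N \<Longrightarrow> padic_abs p (S n) < e"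
      using S by (auto simp: padic_null_iff[OF p])
    have "padic_abs p (S m - S n) < e" if "m \<ge> N" "n \<ge> N" for m n
      using padic_abs_add_less[OF p N[OF that(1)], of "- S n"] N[OF that(2)] by simp
    thus "\<exists>N. \<forall>m\<ge>N. \<forall>n\<ge>N. padic_abs p (S m - S n) < e" by blast
  qed
qed

lemma padic_null_add:
  assumes p: "prime p" and S: "S \<in> padic_null p" and T: "T \<in> padic_null p"
  shows "(\<lambda>n. S n + T n) \<in> padic_null p"
  unfolding padic_null_iff[OF p]
proof safe
  fix e :: real assume e: "e > 0"
  obtain N where "\<And>n. n \<ge> N \<Longrightarrow> padic_abs p (S n) < e"
    using S e by (auto simp: padic_null_iff[OF p])
  moreover obtain M where "\<And>n. n \<ge> M \<Longrightarrow> padic_abs p (T n) < e"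
    using T e by (auto simp: padic_null_iff[OF p])
  ultimately have "\<forall>n\<ge>max M N. padic_abs p (S n + T n) < e" by (auto intro: padic_abs_add_less[OF p])
  thus "\<exists>N. \<forall>n\<ge>N. padic_abs p (S n + T n) < e" by blast
qed

lemma padic_null_uminus: "S \<in> padic_null p \<Longrightarrow> (\<lambda>n. - S n) \<in> padic_null p"
  by (simp add: padic_null_def)

lemma padic_null_mult:
  assumes p: "prime p" and S: "S \<in> padic_null p" and T: "T \<in> padic_Cauchy p"
  shows "(\<lambda>n. S n * T n) \<in> padic_null p"
  unfolding padic_null_iff[OF p]
proof safe
  fix e :: real assume e: "e > 0"
  obtain C where C: "C > 0" "\<And>n. padic_abs p (T n) < C" by (rule padic_Cauchy_bounded[OF p T]) blast
  obtain N where N: "\<And>n. n \<ge> N \<Longrightarrow> padic_abs p (S n) < e / C"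
    using S divide_pos_pos[OF e C(1)] unfolding padic_null_iff[OF p] by blast
  have "padic_abs p (S n * T n) < e / C * C" if "n \<ge> N" for n
    unfolding padic_abs_mult[OF p]
    using N[of n] C that padic_abs_nonneg[OF p] by (intro mult_strict_mono') auto
  thus "\<exists>N. \<forall>n\<ge>N. padic_abs p (S n * T n) < e" using C by auto
qed

lemma padic_Cauchy_inverse:
  assumes p: "prime p" and S: "S \<in> padic_Cauchy p" and nS: "S \<notin> padic_null p"
  shows "(\<lambda>n. inverse (S n)) \<in> padic_Cauchy p" "(\<lambda>n. S n * inverse (S n) - 1) \<in> padic_null p"
proof -
  obtain e where e: "e > 0" "\<And>N. \<exists>n\<ge>N. padic_abs p (S n) \<ge> e"
    using nS unfolding padic_null_iff[OF p] by (meson not_less)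
  obtain N where N: "\<And>m n. m \<ge> N \<Longrightarrow> n \<ge> N \<Longrightarrow> padic_abs p (S m - S n) < e"
    using S e by (force simp: padic_Cauchy_def)
  have ge: "padic_abs p (S n) \<ge> e" if n: "n \<ge> N" for n
  proof (rule ccontr)
    assume "\<not> ?thesis"
    moreover obtain m where m: "m \<ge> N" "padic_abs p (S m) \<ge> e" using e by blast
    ultimately have "padic_abs p (S n + (S m - S n)) < e"
      using N[OF m(1) n] by (intro padic_abs_add_less[OF p]) auto
    thus False using m by simp
  qed
  hence nz: "S n \<noteq> 0" if "n \<ge> N" for n using that e(1) by fastforce
  show "(\<lambda>n. inverse (S n)) \<in> padic_Cauchy p" unfolding padic_Cauchy_def
  proof safe
    fix r :: real assume r: "r > 0"
    obtain M where M: "\<And>m n. m \<ge> M \<Longrightarrow> n \<ge> M \<Longrightarrow> padic_abs p (S m - S n) < r * (e * e)"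
      using S e r by (force simp: padic_Cauchy_def)
    have "padic_abs p (inverse (S m) - inverse (S n)) < r"
      if mn: "m \<ge> max M N" "n \<ge> max M N" for m n
    proof -
      have "padic_abs p (inverse (S m) - inverse (S n)) * (padic_abs p (S m) * padic_abs p (S n))
              = padic_abs p (S n - S m)"
        using nz[of m] nz[of n] mn by (simp add: field_simps flip: padic_abs_mult[OF p])
      also have "\<dots> < r * (e * e)" using M mn by auto
      also have "\<dots> \<le> r * (padic_abs p (S m) * padic_abs p (S n))"
        using ge[of m] ge[of n] mn e r by (intro mult_left_mono mult_mono) auto
      finally show ?thesis
        by (rule mult_right_less_imp_less) (simp add: padic_abs_nonneg[OF p])
    qed
    thus "\<exists>N. \<forall>m\<ge>N. \<forall>n\<ge>N. padic_abs p (inverse (S m) - inverse (S n)) < r" by blast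
  qed
  show "(\<lambda>n. S n * inverse (S n) - 1) \<in> padic_null p"
    unfolding padic_null_iff[OF p] using nz by (intro allI impI exI[of _ N]) auto
qed

lemma padic_Cauchy_cring:
  assumes p: "prime p"
  shows "cring (padic_Cauchy_ring p)"
proof (rule cringI)
  show "abelian_group (padic_Cauchy_ring p)"
  proof (rule abelian_groupI, goal_cases)
    case (6 S)
    thus ?case by (intro bexI[of _ "\<lambda>n. - S n"])
        (auto simp: padic_Cauchy_ring_def padic_Cauchy_uminus)
  qed (auto simp: padic_Cauchy_ring_def padic_Cauchy_add[OF p] algebra_simps)
  show "Group.comm_monoid (padic_Cauchy_ring p)"
    by (rule Group.comm_monoidI)
      (auto simp: padic_Cauchy_ring_def padic_Cauchy_mult[OF p] algebra_simps)
qed (auto simp: padic_Cauchy_ring_def algebra_simps)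

lemma padic_null_ideal:
  assumes p: "prime p"
  shows "ideal (padic_null p) (padic_Cauchy_ring p)"
proof -
  interpret cring "padic_Cauchy_ring p" by (rule padic_Cauchy_cring[OF p])
  show ?thesis
  proof (rule idealI)
    show "subgroup (padic_null p) (add_monoid (padic_Cauchy_ring p))"
    proof (rule add.subgroupI)
      fix S assume S: "S \<in> padic_null p"
      hence "\<ominus>\<^bsub>padic_Cauchy_ring p\<^esub> S = (\<lambda>n. - S n)"
        using padic_null_subset[OF p]
        by (intro minus_equality) (auto simp: padic_Cauchy_ring_def padic_Cauchy_uminus)
      thus "\<ominus>\<^bsub>padic_Cauchy_ring p\<^esub> S \<in> padic_null p"
        using padic_null_uminus[OF S] by simp
    qed (use padic_null_subset[OF p] padic_null_add[OF p] in
          \<open>auto simp: padic_Cauchy_ring_def padic_null_def intro!: exI[of _ "\<lambda>_. 0"]\<close>)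
  qed (use padic_null_mult[OF p] in
        \<open>auto simp: padic_Cauchy_ring_def mult.commute intro: ring_axioms[unfolded padic_Cauchy_ring_def]\<close>)
qed

lemma padic_numbers_field:
  assumes p: "prime p"
  shows "field (padic_numbers p)"
proof -
  interpret cring "padic_Cauchy_ring p" by (rule padic_Cauchy_cring[OF p])
  interpret I: ideal "padic_null p" "padic_Cauchy_ring p" by (rule padic_null_ideal[OF p])
  have "maximalideal (padic_null p) (padic_Cauchy_ring p)"
  proof (rule maximalidealI)
    show "ideal (padic_null p) (padic_Cauchy_ring p)" by (rule padic_null_ideal[OF p])
    have "(\<lambda>_. 1) \<notin> padic_null p" by (simp add: padic_null_def LIMSEQ_const_iff)
    moreover have "(\<lambda>_. 1) \<in> carrier (padic_Cauchy_ring p)" by (simp add: padic_Cauchy_ring_def)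
    ultimately show "carrier (padic_Cauchy_ring p) \<noteq> padic_null p" by blast
  next
    fix J assume J: "ideal J (padic_Cauchy_ring p)" "padic_null p \<subseteq> J"
      "J \<subseteq> carrier (padic_Cauchy_ring p)"
    interpret J: ideal J "padic_Cauchy_ring p" by (rule J(1))
    show "J = padic_null p \<or> J = carrier (padic_Cauchy_ring p)"
    proof (cases "J = padic_null p")
      case False
      then obtain S where S: "S \<in> J" "S \<notin> padic_null p" using J(2) by blast
      have SC: "S \<in> padic_Cauchy p" using S J(3) by (auto simp: padic_Cauchy_ring_def)
      note inv = padic_Cauchy_inverse[OF p SC S(2)]
      have 1: "(\<lambda>n. S n * inverse (S n)) \<in> J"
        using J.I_r_closed[OF S(1), of "\<lambda>n. inverse (S n)"] inv(1)
        by (simp add: padic_Cauchy_ring_def)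
      have 2: "(\<lambda>n. - (S n * inverse (S n) - 1)) \<in> J"
        using padic_null_uminus[OF inv(2)] J(2) by blast
      have "(\<lambda>_. 1) \<in> J"
        using J.a_closed[OF 1 2] by (simp add: padic_Cauchy_ring_def)
      hence "J = carrier (padic_Cauchy_ring p)"
        using J.one_imp_carrier by (simp add: padic_Cauchy_ring_def)
      thus ?thesis ..
    qed auto
  qed
  from maximalideal.quotient_is_field[OF this is_cring] show ?thesis
    by (simp add: padic_numbers_def)
qed


section \<open>p-adic fields and uniformizers\<close>

text \<open>\<open>padic_field p \<iota>\<close>: the type \<open>'k\<close> is, via the embedding \<open>\<iota>\<close>, a finite
  extension of the field of p-adic numbers. (A ring homomorphism between fields is injective.)\<close>

definition padic_field :: "nat \<Rightarrow> ((nat \<Rightarrow> rat) set \<Rightarrow> 'k :: field) \<Rightarrow> bool" where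
  "padic_field p \<iota> \<longleftrightarrow>
     prime p \<and>
     \<iota> \<in> ring_hom (padic_numbers p) (ring_of_type_algebra :: 'k ring) \<and>
     ring.finite_dimension (ring_of_type_algebra :: 'k ring)
       (\<iota> ` carrier (padic_numbers p)) (UNIV :: 'k set)"

text \<open>The valuation ring of a p-adic field is the integral closure of the p-adic integers.\<close>

definition valuation_ring :: "nat \<Rightarrow> ((nat \<Rightarrow> rat) set \<Rightarrow> 'k :: field) \<Rightarrow> 'k set" where
  "valuation_ring p \<iota> =
     {x. \<exists>q :: 'k poly. Polynomial.lead_coeff q = 1 \<and>
           (\<forall>i. Polynomial.coeff q i \<in> \<iota> ` padic_integers p) \<and> poly q x = 0}"

text \<open>A uniformizer generates the maximal ideal of the valuation ring, i.e. its set of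
  non-units.\<close>

definition uniformizer :: "nat \<Rightarrow> ((nat \<Rightarrow> rat) set \<Rightarrow> 'k :: field) \<Rightarrow> 'k \<Rightarrow> bool" where
  "uniformizer p \<iota> \<pi> \<longleftrightarrow>
     \<pi> \<in> valuation_ring p \<iota> \<and>
     {\<pi> * y | y. y \<in> valuation_ring p \<iota>} =
       {x \<in> valuation_ring p \<iota>. \<not> (\<exists>y \<in> valuation_ring p \<iota>. x * y = 1)}"


section \<open>Rational functions\<close>

text \<open>The rational function field \<open>K(t)\<close> is \<open>'k poly fract\<close>.\<close>

definition const_ratfun :: "'k :: field \<Rightarrow> 'k poly fract" where
  "const_ratfun c = to_fract [:c:]"

definition t_var :: "'k :: field poly fract" where
  "t_var = to_fract [:0, 1:]"

text \<open>Order of vanishing at \<open>t = 0\<close> of a nonzero rational function, as an integer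
  (negative at a pole); the value at the zero function, which should be infinite, is left
  unspecified.\<close>

definition t_valuation :: "'k :: field poly fract \<Rightarrow> int" where
  "t_valuation f =
     (THE n. \<exists>a b. a \<noteq> 0 \<and> b \<noteq> 0 \<and> f = Fract a b \<and>
                   n = int (Polynomial.order 0 a) - int (Polynomial.order 0 b))"

lemma t_valuation_Fract:
  assumes "a \<noteq> 0" "b \<noteq> 0"
  shows "t_valuation (Fract a b) = int (Polynomial.order 0 a) - int (Polynomial.order 0 b)"
  unfolding t_valuation_def
proof (rule the_equality)
  fix n assume "\<exists>c d. c \<noteq> 0 \<and> d \<noteq> 0 \<and> Fract a b = Fract c d \<and>
                 n = int (Polynomial.order 0 c) - int (Polynomial.order 0 d)"
  then obtain c d where cd: "c \<noteq> 0" "d \<noteq> 0" "Fract a b = Fract c d"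
    and n: "n = int (Polynomial.order 0 c) - int (Polynomial.order 0 d)" by blast
  have eq: "a * d = c * b" using cd assms by (simp add: eq_fract)
  have "Polynomial.order 0 a + Polynomial.order 0 d = Polynomial.order 0 c + Polynomial.order 0 b"
    using Polynomial.order_mult[of a d 0] Polynomial.order_mult[of c b 0] eq cd assms by simp
  thus "n = int (Polynomial.order 0 a) - int (Polynomial.order 0 b)" using n by simp
qed (use assms in blast)


section \<open>Diagonal quadratic forms\<close>

text \<open>The diagonal form with diagonal entries \<open>a\<^sub>1, \<dots>, a\<^sub>n\<close> is represented by the list of its
  entries.\<close>

definition form_eval :: "'a :: field list \<Rightarrow> 'a list \<Rightarrow> 'a" where
  "form_eval as xs = (\<Sum>i<length as. as ! i * (xs ! i)\<^sup>2)"

definition anisotropic :: "'a :: field list \<Rightarrow> bool" where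
  "anisotropic as \<longleftrightarrow>
     (\<forall>xs. length xs = length as \<and> form_eval as xs = 0 \<longrightarrow> (\<forall>x\<in>set xs. x = 0))"

text \<open>The tensor product of diagonal forms is the diagonal form with entries \<open>a\<^sub>i b\<^sub>j\<close>.\<close>

definition form_tensor :: "'a :: field list \<Rightarrow> 'a list \<Rightarrow> 'a list" (infixl "\<otimes>\<^sub>q" 70) where
  "as \<otimes>\<^sub>q bs = [a * b. a \<leftarrow> as, b \<leftarrow> bs]"

end

theory Submission
  imports Defs
begin

text \<open>Up to a square, \<open>f\<close> is \<open>t u\<close> with \<open>u\<close> a polynomial such that \<open>c = u(0) \<noteq> 0\<close>. As in Springer's
  theorem for the \<open>t\<close>-adic valuation, the first form is anisotropic as soon as its two residue forms
  \<open>\<langle>1,\<pi>\<rangle> \<otimes> \<langle>1,-\<gamma>\<rangle>\<close> and \<open>\<langle>1,\<pi>\<rangle> \<otimes> \<langle>-1,-c\<rangle>\<close> are anisotropic over \<open>K\<close>; for the second form \<open>c\<close>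
  becomes \<open>\<gamma>c\<close>. If both \<open>\<langle>1,\<pi>\<rangle> \<otimes> \<langle>-1,-c\<rangle>\<close> and \<open>\<langle>1,\<pi>\<rangle> \<otimes> \<langle>-1,-\<gamma>c\<rangle>\<close> were isotropic, then \<open>-c\<close> and
  \<open>-\<gamma>c\<close> would be nonzero values of \<open>\<langle>1,\<pi>\<rangle>\<close>. These values form a group, so \<open>\<gamma>\<close> would be such
  a value, contradicting the anisotropy of \<open>\<langle>1,\<pi>\<rangle> \<otimes> \<langle>1,-\<gamma>\<rangle>\<close>.\<close>

lemma form_eval_Nil [simp]: "form_eval [] xs = 0"
  by (simp add: form_eval_def)

lemma form_eval_Cons [simp]: "form_eval (a # as) (x # xs) = a * x\<^sup>2 + form_eval as xs"
  by (simp add: form_eval_def sum.lessThan_Suc_shift del: sum.lessThan_Suc)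

lemma form_eval_append:
  "length xs = length as \<Longrightarrow> form_eval (as @ bs) (xs @ ys) = form_eval as xs + form_eval bs ys"
  by (induction xs as rule: list_induct2) (auto simp: algebra_simps)

lemma form_eval_scale:
  "length xs = length as \<Longrightarrow> form_eval as (map ((*) c) xs) = c\<^sup>2 * form_eval as xs"
  by (induction xs as rule: list_induct2) (auto simp: algebra_simps power2_eq_square)

lemma form_eval_mult_left:
  "length xs = length as \<Longrightarrow> form_eval (map ((*) c) as) xs = c * form_eval as xs"
  by (induction xs as rule: list_induct2) (auto simp: algebra_simps)

text \<open>The sum over \<open>zip\<close> stands in for \<open>form_eval\<close> at the polynomial
  level, since \<open>form_eval\<close> is typed over fields and polynomials only form a
  ring.\<close>

lemma form_eval_to_fract:
  "length ps = length as \<Longrightarrow>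
     form_eval (map to_fract as) (map to_fract ps) = to_fract (\<Sum>(a, p)\<leftarrow>zip as ps. a * p\<^sup>2)"
  by (induction ps as rule: list_induct2) (auto simp: power2_eq_square)

lemma poly_form_const:
  fixes as ps :: "'k :: field poly list"
  shows "length ps = length as \<Longrightarrow>
     poly (\<Sum>(a, p)\<leftarrow>zip as ps. a * p\<^sup>2) 0 = form_eval (map (\<lambda>a. poly a 0) as) (map (\<lambda>p. poly p 0) ps)"
  by (induction ps as rule: list_induct2) auto

lemma poly_form_dvd:
  fixes as ps :: "'a :: comm_ring_1 list"
  shows "length ps = length as \<Longrightarrow> \<forall>p\<in>set ps. c dvd p \<Longrightarrow> c\<^sup>2 dvd (\<Sum>(a, p)\<leftarrow>zip as ps. a * p\<^sup>2)"
  by (induction ps as rule: list_induct2) (auto simp: dvd_power_same)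

lemma common_denominator:
  fixes xs :: "'a :: idom fract list"
  obtains d ps where "d \<noteq> 0" "map ((*) (to_fract d)) xs = map to_fract ps"
proof -
  have "\<exists>d ps. d \<noteq> 0 \<and> map ((*) (to_fract d)) xs = map to_fract ps"
  proof (induction xs)
    case Nil
    show ?case by (intro exI[of _ 1] exI[of _ "[]"]) simp
  next
    case (Cons x xs)
    then obtain d ps where IH: "d \<noteq> 0" "map ((*) (to_fract d)) xs = map to_fract ps"
      by blast
    obtain a b where x: "x = Fract a b" "b \<noteq> 0"
      by (cases x) auto
    have "map ((*) (to_fract (b * d))) xs = map ((*) (to_fract b)) (map ((*) (to_fract d)) xs)"
      by (simp add: algebra_simps)
    also have "\<dots> = map to_fract (map ((*) b) ps)"
      by (simp add: IH)
    finally have "map ((*) (to_fract (b * d))) (x # xs) = map to_fract (d * a # map ((*) b) ps)"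
      using x by (simp add: to_fract_def eq_fract algebra_simps)
    thus ?case using IH x by (intro exI[of _ "b * d"] exI[of _ "d * a # map ((*) b) ps"]) simp
  qed
  thus ?thesis using that by blast
qed

lemma dvd_t_iff: "[:0, 1:] dvd p \<longleftrightarrow> poly p (0 :: 'k :: field) = 0"
  using poly_eq_0_iff_dvd[of p 0] by simp

lemma divide_out_t:
  fixes ps :: "'k :: field poly list"
  assumes "q \<in> set ps" "q \<noteq> 0"
  obtains n qs where "ps = map ((*) ([:0, 1:] ^ n)) qs" "\<exists>q\<in>set qs. poly q 0 \<noteq> 0"
proof -
  \<comment> \<open>The least order at 0 among the nonzero entries. Dividing by this power of t
    keeps all entries polynomial and leaves one with nonzero constant term.\<close>
  define n where "n = (LEAST n. \<exists>p\<in>set ps. p \<noteq> 0 \<and> Polynomial.order 0 p = n)"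
  have "\<exists>p\<in>set ps. p \<noteq> 0 \<and> Polynomial.order 0 p = n"
    unfolding n_def by (rule LeastI_ex) (use assms in blast)
  then obtain p where p: "p \<in> set ps" "p \<noteq> 0" "Polynomial.order 0 p = n" by blast
  have dvd: "[:0, 1:] ^ n dvd r" if "r \<in> set ps" for r
  proof (cases "r = 0")
    case False
    hence "n \<le> Polynomial.order 0 r"
      unfolding n_def using that by (intro Least_le) blast
    thus ?thesis using order_divides[of 0 n r] by simp
  qed auto
  define qs where "qs = map (\<lambda>r. r div [:0, 1:] ^ n) ps"
  have ps: "ps = map ((*) ([:0, 1:] ^ n)) qs"
    using dvd by (auto simp: qs_def intro!: map_idI[symmetric])
  obtain q where q: "q \<in> set qs" "p = [:0, 1:] ^ n * q"
    using p(1) by (subst (asm) ps) auto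
  have "poly q 0 \<noteq> 0"
  proof
    assume "poly q 0 = 0"
    hence "[:0, 1:] ^ Suc n dvd p"
      unfolding q(2) power_Suc2 by (intro mult_dvd_mono) (simp_all add: dvd_t_iff)
    thus False using order_divides[of 0 "Suc n" p] p by simp
  qed
  thus ?thesis using that ps q(1) by blast
qed

text \<open>Forms are homogeneous, so a nontrivial zero over K(t) may be rescaled: clear
  denominators, then cancel the common power of t. The result can be reduced at t = 0 without
  becoming trivial.\<close>

lemma primitive_representative:
  fixes xs :: "'k :: field poly fract list"
  assumes "x \<in> set xs" "x \<noteq> 0"
  obtains c qs where "map ((*) c) xs = map to_fract qs" "\<exists>q\<in>set qs. poly q 0 \<noteq> 0"
proof -
  obtain d ps where d: "d \<noteq> 0" "map ((*) (to_fract d)) xs = map to_fract ps"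
    by (rule common_denominator)
  have "to_fract d * x \<in> set (map to_fract ps)"
    using assms(1) unfolding d(2)[symmetric] set_map by (rule imageI)
  then obtain q where "q \<in> set ps" "to_fract q = to_fract d * x" by auto
  hence "q \<in> set ps" "q \<noteq> 0" using d assms by auto
  then obtain n qs where qs: "ps = map ((*) ([:0, 1:] ^ n)) qs" "\<exists>q\<in>set qs. poly q 0 \<noteq> 0"
    by (rule divide_out_t)
  define s where "s = to_fract ([:0, 1:] ^ n :: 'k poly)"
  have s: "s \<noteq> 0" by (simp add: s_def)
  have "map ((*) (inverse s * to_fract d)) xs = map ((*) (inverse s)) (map ((*) (to_fract d)) xs)"
    by (simp add: mult.assoc)
  also have "\<dots> = map to_fract qs"
    using s by (simp add: d(2) qs(1) s_def[symmetric] flip: mult.assoc)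
  finally show ?thesis using that qs(2) by blast
qed

lemma anisotropicD:
  "anisotropic as \<Longrightarrow> length xs = length as \<Longrightarrow> form_eval as xs = 0 \<Longrightarrow> x \<in> set xs \<Longrightarrow> x = 0"
  by (auto simp: anisotropic_def)

text \<open>A primitive zero splits as P + tQ = 0 with P, Q values of the two polynomial forms.
  Reducing modulo t, and then once more after cancelling t, makes every coordinate vanish at 0,
  against primitivity.\<close>

lemma anisotropic_residue_forms:
  fixes as bs :: "'k :: field poly list"
  assumes as: "anisotropic (map (\<lambda>a. poly a 0) as)" and bs: "anisotropic (map (\<lambda>b. poly b 0) bs)"
  shows "anisotropic (map to_fract as @ map ((*) t_var) (map to_fract bs))"
  unfolding anisotropic_def
proof (intro allI impI ballI, elim conjE, rule ccontr)
  fix xs and x :: "'k poly fract"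
  let ?F = "map to_fract as @ map ((*) t_var) (map to_fract bs)"
  assume len: "length xs = length ?F" and eval: "form_eval ?F xs = 0" and "x \<in> set xs" "x \<noteq> 0"
  obtain c qs where c: "map ((*) c) xs = map to_fract qs" and qs: "\<exists>q\<in>set qs. poly q 0 \<noteq> 0"
    by (rule primitive_representative[OF \<open>x \<in> set xs\<close> \<open>x \<noteq> 0\<close>])
  define ys zs where "ys = take (length as) qs" and "zs = drop (length as) qs"
  define P Q where "P = (\<Sum>(a, p)\<leftarrow>zip as ys. a * p\<^sup>2)" and "Q = (\<Sum>(b, p)\<leftarrow>zip bs zs. b * p\<^sup>2)"
  have "length qs = length xs" using arg_cong[OF c, of length] by simp
  hence l: "length ys = length as" "length zs = length bs" and qsyz: "qs = ys @ zs"
    using len by (simp_all add: ys_def zs_def)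
  have "form_eval ?F (map to_fract ys @ map to_fract zs) = 0"
    using form_eval_scale[OF len, of c] eval by (simp add: c qsyz del: map_map)
  hence "to_fract (P + [:0, 1:] * Q) = 0"
    using l unfolding to_fract_add to_fract_mult
    by (simp add: form_eval_append form_eval_mult_left form_eval_to_fract P_def Q_def t_var_def
        del: map_map)
  hence PQ: "P + [:0, 1:] * Q = 0" by (simp only: to_fract_eq_0_iff)
  have "poly P 0 = 0" using arg_cong[OF PQ, of "\<lambda>p. poly p 0"] by simp
  hence ys0: "\<forall>y\<in>set ys. poly y 0 = 0"
    using anisotropicD[OF as, of "map (\<lambda>p. poly p 0) ys"] poly_form_const[OF l(1)] l
    by (auto simp: P_def)
  \<comment> \<open>P is quadratic in coordinates divisible by t, so it gains t^2; one factor t is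
    left for Q after cancelling.\<close>
  hence "[:0, 1:]\<^sup>2 dvd P"
    unfolding P_def using l by (intro poly_form_dvd) (auto simp: dvd_t_iff)
  hence "[:0, 1:]\<^sup>2 dvd [:0, 1:] * Q"
    using PQ by (metis add_eq_0_iff dvd_minus_iff)
  hence "[:0, 1:] dvd Q"
    unfolding power2_eq_square by (subst (asm) dvd_mult_cancel_left) simp
  hence "poly Q 0 = 0" by (simp add: dvd_t_iff)
  hence "\<forall>z\<in>set zs. poly z 0 = 0"
    using anisotropicD[OF bs, of "map (\<lambda>p. poly p 0) zs"] poly_form_const[OF l(2)] l
    by (auto simp: Q_def)
  thus False using ys0 qs by (auto simp: qsyz)
qed

lemma isotropic_obtain:
  assumes "\<not> anisotropic ([1, a] \<otimes>\<^sub>q [-1, -c])"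
  obtains x y z w where "x\<^sup>2 + a * y\<^sup>2 = - c * (z\<^sup>2 + a * w\<^sup>2)" "x \<noteq> 0 \<or> y \<noteq> 0 \<or> z \<noteq> 0 \<or> w \<noteq> 0"
proof -
  obtain xs where xs: "length xs = 4" "form_eval ([1, a] \<otimes>\<^sub>q [-1, -c]) xs = 0" "\<exists>x\<in>set xs. x \<noteq> 0"
    using assms by (auto simp: anisotropic_def form_tensor_def numeral_eq_Suc)
  \<comment> \<open>The tensor product lists its entries as -1, -c, -a, -ac, hence the order x, z,
    y, w.\<close>
  then obtain x z y w where "xs = [x, z, y, w]"
    by (auto simp: numeral_eq_Suc length_Suc_conv)
  moreover from this have "x\<^sup>2 + a * y\<^sup>2 - - c * (z\<^sup>2 + a * w\<^sup>2) = - form_eval ([1, a] \<otimes>\<^sub>q [-1, -c]) xs"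
    by (simp add: form_tensor_def algebra_simps)
  ultimately show ?thesis using xs that[of x y z w]
    by (auto simp: eq_neg_iff_add_eq_0)
qed

lemma anisotropic_binary_tensor:
  fixes a c g :: "'k :: field"
  assumes an: "anisotropic ([1, a] \<otimes>\<^sub>q [1, - g])" and c: "c \<noteq> 0" and g: "g \<noteq> 0"
  shows "anisotropic ([1, a] \<otimes>\<^sub>q [-1, -c]) \<or> anisotropic ([1, a] \<otimes>\<^sub>q [-1, -(g * c)])"
proof (rule ccontr)
  define N where "N x y = x\<^sup>2 + a * y\<^sup>2" for x y
  \<comment> \<open>Brahmagupta's identity: N is the norm form attached to a square root of
    -a.\<close>
  have mult: "N x y * N z w = N (x * z - a * y * w) (x * w + y * z)" for x y z w
    by (simp add: N_def algebra_simps power2_eq_square)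
  have rep: "x = 0 \<and> y = 0 \<and> z = 0 \<and> w = 0" if "N x y = g * N z w" for x y z w
    using anisotropicD[OF an, of "[x, z, y, w]"] that
    by (auto simp: N_def form_tensor_def algebra_simps)
  have N0: "N x y = 0 \<longleftrightarrow> x = 0 \<and> y = 0" for x y
    using rep[of x y 0 0] by (auto simp: N_def)
  assume "\<not> ?thesis"
  then obtain x y z w x' y' z' w' where
    eq: "N x y = - c * N z w" "N x' y' = - (g * c) * N z' w'" and
    nz: "x \<noteq> 0 \<or> y \<noteq> 0 \<or> z \<noteq> 0 \<or> w \<noteq> 0" "x' \<noteq> 0 \<or> y' \<noteq> 0 \<or> z' \<noteq> 0 \<or> w' \<noteq> 0"
    unfolding N_def by (metis isotropic_obtain)
  have "N z w \<noteq> 0" using eq(1) nz(1) N0[of x y] N0[of z w] by auto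
  moreover have "N x' y' \<noteq> 0"
    using eq(2) nz(2) c g N0[of x' y'] N0[of z' w'] by auto
  ultimately have "N x' y' * N z w \<noteq> 0" by simp
  \<comment> \<open>Cross-multiplying the two relations eliminates c without inverting values of N.
    Both sides are then g-related values of N, which \<open>rep\<close> forces to be
    trivial.\<close>
  moreover have "N x' y' * N z w = g * (N x y * N z' w')"
    by (simp add: eq)
  ultimately show False
    using rep[of "x' * z - a * y' * w" "x' * w + y' * z" "x * z' - a * y * w'" "x * w' + y * z'"]
      N0[of "x' * z - a * y' * w" "x' * w + y' * z"] by (simp add: mult)
qed

text \<open>Since a/b = ab/b^2, the polynomial ab carries the parity of the valuation, and the even
  part of its power of t goes into the square.\<close>

lemma odd_t_valuation_obtain:
  fixes f :: "'k :: field poly fract"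
  assumes "f \<noteq> 0" "odd (t_valuation f)"
  obtains s u where "s \<noteq> 0" "poly u 0 \<noteq> 0" "f = s\<^sup>2 * (t_var * to_fract u)"
proof -
  obtain a b where f: "f = Fract a b" "b \<noteq> 0" by (cases f) auto
  have a: "a \<noteq> 0" using f assms(1) by (auto simp: fract_collapse)
  have "odd (int (Polynomial.order 0 a) - int (Polynomial.order 0 b))"
    using assms(2) a f by (simp add: t_valuation_Fract)
  hence "odd (Polynomial.order 0 (a * b))"
    using a f by (simp add: Polynomial.order_mult)
  then obtain k where k: "Polynomial.order 0 (a * b) = 2 * k + 1" by (rule oddE)
  obtain u where u: "a * b = [:0, 1:] ^ (2 * k + 1) * u" "\<not> [:0, 1:] dvd u"
    using order_decomp[of "a * b" 0] a f k by auto
  define t where "t = (t_var :: 'k poly fract)"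
  define s where "s = t ^ k / to_fract b"
  have t0: "t \<noteq> 0" by (simp add: t_def t_var_def)
  have pw: "to_fract ([:0, 1:] ^ n) = t ^ n" for n :: nat
    by (induction n) (simp_all only: power_0 power_Suc to_fract_1 to_fract_mult t_def t_var_def)
  have "f = to_fract a / to_fract b"
    using f by (simp add: Fract_conv_to_fract)
  also have "\<dots> = to_fract (a * b) / (to_fract b)\<^sup>2"
    using f by (simp add: power2_eq_square)
  also have "\<dots> = s\<^sup>2 * (t * to_fract u)"
    unfolding u(1) to_fract_mult pw s_def
    by (simp add: power_divide power_mult[symmetric] mult_ac)
  finally show ?thesis
    using that[of s u] u(2) t0 f by (auto simp: s_def t_def dvd_t_iff)
qed

text \<open>The diagonal entries are sorted by the parity of their t-valuation, and the square
  factor of f is absorbed into the coordinates.\<close>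

lemma anisotropic_ratfun:
  fixes a g :: "'k :: field" and f :: "'k poly fract"
  assumes f: "s \<noteq> 0" "f = s\<^sup>2 * (t_var * to_fract u)"
    and an: "anisotropic ([1, a] \<otimes>\<^sub>q [1, - g])" "anisotropic ([1, a] \<otimes>\<^sub>q [-1, - poly u 0])"
  shows "anisotropic ([1, const_ratfun a] \<otimes>\<^sub>q [1, - const_ratfun g, - t_var, - f])"
  unfolding anisotropic_def
proof (intro allI impI, elim conjE)
  fix xs
  let ?F = "[1, const_ratfun a] \<otimes>\<^sub>q [1, - const_ratfun g, - t_var, - f]"
  \<comment> \<open>The entries of even and of odd valuation, the latter stripped of t and
    \<open>s\<^sup>2\<close>. At t = 0 they become the two residue forms assumed
    anisotropic.\<close>
  let ?as = "[1, - [:g:], [:a:], - ([:a:] * [:g:])]" and ?bs = "[- 1, - u, - [:a:], - [:a:] * u]"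
  let ?G = "map to_fract ?as @ map ((*) t_var) (map to_fract ?bs)"
  assume len: "length xs = length ?F" and eval: "form_eval ?F xs = 0"
  obtain x1 x2 x3 x4 x5 x6 x7 x8 where xs: "xs = [x1, x2, x3, x4, x5, x6, x7, x8]"
    using len by (auto simp: form_tensor_def length_Suc_conv numeral_eq_Suc)
  let ?a = "const_ratfun a" and ?g = "const_ratfun g" and ?u = "to_fract u"
  have G: "?G = [1, - ?g, ?a, - (?a * ?g), t_var * (- 1), t_var * (- ?u), t_var * (- ?a), t_var * (- ?a * ?u)]"
    by (simp only: list.map append.simps const_ratfun_def to_fract_1 to_fract_uminus to_fract_mult)
  have "anisotropic ?G"
    by (rule anisotropic_residue_forms) (use an in \<open>simp_all add: form_tensor_def mult.commute\<close>)
  moreover have "form_eval ?G [x1, x2, x5, x6, x3, s * x4, x7, s * x8] = form_eval ?F xs"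
    unfolding G xs f(2) by (simp add: form_tensor_def algebra_simps)
  ultimately have "\<forall>x\<in>set [x1, x2, x5, x6, x3, s * x4, x7, s * x8]. x = 0"
    using eval anisotropicD[of ?G "[x1, x2, x5, x6, x3, s * x4, x7, s * x8]"] by auto
  thus "\<forall>x\<in>set xs. x = 0" using f(1) by (simp add: xs)
qed

theorem theorem5p1:
  fixes p :: nat
    and \<iota> :: "(nat \<Rightarrow> rat) set \<Rightarrow> 'k :: field"
    and \<pi> \<gamma> :: 'k
    and f :: "'k poly fract"
  assumes "padic_field p \<iota>"
    and "uniformizer p \<iota> \<pi>"
    and "\<gamma> \<noteq> 0"
    and "anisotropic ([1, \<pi>] \<otimes>\<^sub>q [1, - \<gamma>])"
    and "f \<noteq> 0"
    and "odd (t_valuation f)"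
  shows "anisotropic ([1, const_ratfun \<pi>] \<otimes>\<^sub>q [1, - const_ratfun \<gamma>, - t_var, - f]) \<or>
         anisotropic ([1, const_ratfun \<pi>] \<otimes>\<^sub>q
                      [1, - const_ratfun \<gamma>, - t_var, - (const_ratfun \<gamma> * f)])"
proof -
  obtain s u where su: "s \<noteq> 0" "poly u 0 \<noteq> 0" "f = s\<^sup>2 * (t_var * to_fract u)"
    using odd_t_valuation_obtain[OF assms(5,6)] .
  \<comment> \<open>Passing from f to \<gamma>f keeps s and only scales u, so the residue c = u(0)
    becomes \<gamma>c.\<close>
  have "const_ratfun \<gamma> * f = s\<^sup>2 * (t_var * to_fract ([:\<gamma>:] * u))"
    by (simp only: su(3) const_ratfun_def to_fract_mult mult_ac)
  moreover have "poly ([:\<gamma>:] * u) 0 = \<gamma> * poly u 0" by simp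
  ultimately show ?thesis
    using anisotropic_binary_tensor[OF assms(4) su(2) assms(3)] anisotropic_ratfun[OF su(1) _ assms(4)]
      su(3) by metis
qed

end
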